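(* Let $H$ be a separable infinite-dimensional complex Hilbert space with orthonormal basis $E=(e_n)_{n\in\mathbb{N}}$. Let $\mathcal{T}$ be any one of the following topologies on $B(H)$: weak operator, ultraweak, strong operator, strong$^*$ operator, ultrastrong, ultrastrong$^*$, Arens–Mackey, weak Banach, norm. Then the $\mathcal{T}$-closed convex hull of $\pi(\mathrm{S}_{\mathbb{N}})$ is not the set of doubly stochastic matrices: $\overline{\mathrm{co}}^{\mathcal{T}}\,\pi(\mathrm{S}_{\mathbb{N}})\neq \mathrm{DS}$.
   Context: For $a\in B(H)$ write $a_{mk}=\langle ae_k,e_m\rangle$. $\mathrm{S}_{\mathbb{N}}$ is the group of all bijections $\mathbb{N}\to\mathbb{N}$, and $\pi:\mathrm{S}_{\mathbb{N}}\to B(H)$ is given by $\pi(\rho)e_n=e_{\rho(n)}$. $\mathrm{DS}=\{a\in B(H): a_{mk}\ge 0,\ \sum_{k=1}^\infty a_{mk}=\sum_{k=1}^\infty a_{km}=1\text{ for all } m,k\}$. The Arens–Mackey topology is the Mackey topology $\tau(B(H),B(H)_* )$, where $B(H)_*$ is the predual of $B(H)$. The weak Banach topology is $\sigma(B(H),B(H)^* )$, where $B(H)^*$ is the norm dual. $\overline{\mathrm{co}}^{\mathcal{T}}$ denotes the $\mathcal{T}$-closure of the convex hull. *)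

theory Defs
  imports "HOL-Analysis.Analysis"
begin

section \<open>Complex Hilbert spaces\<close>

text \<open>The library has real inner product spaces only.  A complex one is a real inner product space
  with a compatible complex scalar multiplication and a sesquilinear form (linear in the first
  argument) whose real part is the real inner product, so that norm and topology are the
  inherited ones.\<close>

class complex_inner = real_inner +
  fixes scaleC :: "complex \<Rightarrow> 'a \<Rightarrow> 'a" (infixr "*\<^sub>C" 75)
    and cinner :: "'a \<Rightarrow> 'a \<Rightarrow> complex"
  assumes scaleC_add_right: "c *\<^sub>C (x + y) = c *\<^sub>C x + c *\<^sub>C y"
    and scaleC_add_left: "(c + d) *\<^sub>C x = c *\<^sub>C x + d *\<^sub>C x"
    and scaleC_scaleC: "c *\<^sub>C (d *\<^sub>C x) = (c * d) *\<^sub>C x"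
    and scaleC_complex_of_real: "complex_of_real r *\<^sub>C x = r *\<^sub>R x"
    and cinner_commute: "cinner x y = cnj (cinner y x)"
    and cinner_add_left: "cinner (x + y) z = cinner x z + cinner y z"
    and cinner_scaleC_left: "cinner (c *\<^sub>C x) y = c * cinner x y"
    and Re_cinner: "Re (cinner x y) = inner x y"

class complex_hilbert = complex_inner + banach

lemma vector_space_scaleC: "vector_space (scaleC :: complex \<Rightarrow> 'a::complex_inner \<Rightarrow> 'a)"
proof
  fix x :: 'a
  show "1 *\<^sub>C x = x"
    using scaleC_complex_of_real[of 1 x] by simp
qed (simp_all add: scaleC_add_right scaleC_add_left scaleC_scaleC)

lemma cinner_self: "cinner x x = complex_of_real ((norm x)\<^sup>2)"
  using Re_cinner[of x x] cinner_commute[of x x]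
  by (simp add: complex_eq_iff power2_norm_eq_inner)

lemma norm_scaleC: "norm (c *\<^sub>C x) = cmod c * norm (x :: 'a::complex_inner)"
proof -
  have "complex_of_real ((norm (c *\<^sub>C x))\<^sup>2) = c * cnj (c * cinner x x)"
    by (metis cinner_self cinner_scaleC_left cinner_commute)
  also have "\<dots> = complex_of_real ((cmod c * norm x)\<^sup>2)"
    by (simp add: cinner_self complex_norm_square[symmetric] power_mult_distrib mult.assoc[symmetric]
          del: of_real_power)
  finally have "(norm (c *\<^sub>C x))\<^sup>2 = (cmod c * norm x)\<^sup>2"
    by (simp only: of_real_eq_iff)
  then show ?thesis
    by (simp add: power2_eq_iff_nonneg)
qed

definition is_orthonormal_basis :: "(nat \<Rightarrow> 'a::complex_hilbert) \<Rightarrow> bool" where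
  "is_orthonormal_basis e \<longleftrightarrow>
     (\<forall>m n. cinner (e m) (e n) = (if m = n then 1 else 0)) \<and>
     closure (module.span scaleC (range e)) = UNIV"


section \<open>The algebra of bounded operators\<close>

text \<open>\<open>B(H)\<close> is the set of complex-linear elements of the type of bounded real-linear maps, whose
  norm is the operator norm.\<close>

definition BH :: "('a::complex_hilbert \<Rightarrow>\<^sub>L 'a) set" where
  "BH = {a :: 'a \<Rightarrow>\<^sub>L 'a. \<forall>c x. a (c *\<^sub>C x) = c *\<^sub>C a x}"

definition scaleC_op :: "complex \<Rightarrow> ('a::complex_hilbert \<Rightarrow>\<^sub>L 'a) \<Rightarrow> ('a \<Rightarrow>\<^sub>L 'a)" where
  "scaleC_op c a = Blinfun (\<lambda>x. c *\<^sub>C a x)"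

lemma scaleC_op_apply: "blinfun_apply (scaleC_op c a) x = c *\<^sub>C a x"
proof -
  have "bounded_linear (\<lambda>x. c *\<^sub>C a x)"
  proof
    fix x y :: 'a and r :: real
    show "c *\<^sub>C a (x + y) = c *\<^sub>C a x + c *\<^sub>C a y"
      by (simp add: blinfun.add_right scaleC_add_right)
    show "c *\<^sub>C a (r *\<^sub>R x) = r *\<^sub>R (c *\<^sub>C a x)"
      by (metis blinfun.scaleR_right scaleC_complex_of_real scaleC_scaleC mult.commute)
    show "\<exists>K. \<forall>x. norm (c *\<^sub>C a x) \<le> norm x * K"
    proof (intro exI allI)
      fix x
      show "norm (c *\<^sub>C a x) \<le> norm x * (cmod c * norm a)"
        using mult_left_mono[OF norm_blinfun[of a x], of "cmod c"]
        by (simp add: norm_scaleC mult_ac)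
    qed
  qed
  then show ?thesis
    by (simp add: scaleC_op_def bounded_linear_Blinfun_apply)
qed

definition adjoint_op :: "('a::complex_hilbert \<Rightarrow>\<^sub>L 'a) \<Rightarrow> ('a \<Rightarrow>\<^sub>L 'a)" where
  "adjoint_op a = (THE b. b \<in> BH \<and> (\<forall>x y. cinner (blinfun_apply a x) y = cinner x (blinfun_apply b y)))"

definition mat_entry :: "(nat \<Rightarrow> 'a::complex_hilbert) \<Rightarrow> ('a \<Rightarrow>\<^sub>L 'a) \<Rightarrow> nat \<Rightarrow> nat \<Rightarrow> complex" where
  "mat_entry e a m k = cinner (a (e k)) (e m)"

definition DS :: "(nat \<Rightarrow> 'a::complex_hilbert) \<Rightarrow> ('a \<Rightarrow>\<^sub>L 'a) set" where
  "DS e = {a \<in> BH. (\<forall>m k. mat_entry e a m k \<in> \<real>\<^sub>\<ge>\<^sub>0) \<and>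
     (\<forall>m. (\<lambda>k. mat_entry e a m k) sums 1) \<and> (\<forall>m. (\<lambda>k. mat_entry e a k m) sums 1)}"

definition perm_op :: "(nat \<Rightarrow> 'a::complex_hilbert) \<Rightarrow> (nat \<Rightarrow> nat) \<Rightarrow> ('a \<Rightarrow>\<^sub>L 'a)" where
  "perm_op e \<rho> = (THE u. u \<in> BH \<and> (\<forall>n. blinfun_apply u (e n) = e (\<rho> n)))"


section \<open>Functionals on the algebra\<close>

text \<open>Functionals are functions on \<open>BH\<close>, extended by \<open>undefined\<close> outside of it.\<close>

definition norm_dual :: "(('a::complex_hilbert \<Rightarrow>\<^sub>L 'a) \<Rightarrow> complex) set" where
  "norm_dual = {f \<in> extensional BH.
     (\<forall>a\<in>BH. \<forall>b\<in>BH. f (a + b) = f a + f b) \<and>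
     (\<forall>c. \<forall>a\<in>BH. f (scaleC_op c a) = c * f a) \<and>
     (\<exists>M. \<forall>a\<in>BH. cmod (f a) \<le> M * norm a)}"

definition square_summable :: "(nat \<Rightarrow> 'a::real_normed_vector) \<Rightarrow> bool" where
  "square_summable x \<longleftrightarrow> summable (\<lambda>n. (norm (x n))\<^sup>2)"

text \<open>The predual of \<open>B(H)\<close>, realised as the space of normal functionals.\<close>

definition predual :: "(('a::complex_hilbert \<Rightarrow>\<^sub>L 'a) \<Rightarrow> complex) set" where
  "predual = {(\<lambda>a\<in>BH. \<Sum>n. cinner (blinfun_apply a (x n)) (y n)) | x y. square_summable x \<and> square_summable y}"


section \<open>Topologies on the algebra\<close>

text \<open>The locally convex topology on \<open>BH\<close> given by a nonempty family of seminorms.\<close>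

definition seminorm_topology ::
    "(('a::complex_hilbert \<Rightarrow>\<^sub>L 'a) \<Rightarrow> real) set \<Rightarrow> ('a \<Rightarrow>\<^sub>L 'a) topology" where
  "seminorm_topology P =
     topology_generated_by {{b \<in> BH. p (b - a) < r} | p a r. p \<in> P \<and> a \<in> BH \<and> r > 0}"

text \<open>For a space \<open>F\<close> of linear functionals on \<open>BH\<close>: the topology \<open>\<sigma>(B(H),F)\<close>, the topology
  \<open>\<sigma>(F,B(H))\<close> of pointwise convergence on \<open>F\<close>, and the Mackey topology \<open>\<tau>(B(H),F)\<close> of uniform
  convergence on the absolutely convex \<open>\<sigma>(F,B(H))\<close>-compact subsets of \<open>F\<close>.\<close>

definition weak_topology ::
    "(('a::complex_hilbert \<Rightarrow>\<^sub>L 'a) \<Rightarrow> complex) set \<Rightarrow> ('a \<Rightarrow>\<^sub>L 'a) topology" where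
  "weak_topology F = seminorm_topology {\<lambda>a. cmod (f a) | f. f \<in> F}"

definition pointwise_topology ::
    "(('a::complex_hilbert \<Rightarrow>\<^sub>L 'a) \<Rightarrow> complex) set \<Rightarrow> (('a \<Rightarrow>\<^sub>L 'a) \<Rightarrow> complex) topology" where
  "pointwise_topology F = subtopology (product_topology (\<lambda>_. euclidean) BH) F"

definition absolutely_convex :: "(('a::complex_hilbert \<Rightarrow>\<^sub>L 'a) \<Rightarrow> complex) set \<Rightarrow> bool" where
  "absolutely_convex K \<longleftrightarrow>
     (\<forall>f\<in>K. \<forall>g\<in>K. \<forall>c d. cmod c + cmod d \<le> 1 \<longrightarrow> (\<lambda>a\<in>BH. c * f a + d * g a) \<in> K)"

definition mackey_topology ::
    "(('a::complex_hilbert \<Rightarrow>\<^sub>L 'a) \<Rightarrow> complex) set \<Rightarrow> ('a \<Rightarrow>\<^sub>L 'a) topology" where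
  "mackey_topology F = seminorm_topology
     {\<lambda>a. SUP f\<in>K. cmod (f a) | K.
        K \<noteq> {} \<and> absolutely_convex K \<and> compactin (pointwise_topology F) K}"

definition weak_operator_topology :: "('a::complex_hilbert \<Rightarrow>\<^sub>L 'a) topology" where
  "weak_operator_topology = seminorm_topology {\<lambda>a. cmod (cinner (blinfun_apply a x) y) | x y. True}"

definition ultraweak_topology :: "('a::complex_hilbert \<Rightarrow>\<^sub>L 'a) topology" where
  "ultraweak_topology = weak_topology predual"

definition strong_star_operator_topology :: "('a::complex_hilbert \<Rightarrow>\<^sub>L 'a) topology" where
  "strong_star_operator_topology =
     seminorm_topology ({\<lambda>a. norm (blinfun_apply a x) | x. True} \<union> {\<lambda>a. norm (blinfun_apply (adjoint_op a) x) | x. True})"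

definition ultrastrong_topology :: "('a::complex_hilbert \<Rightarrow>\<^sub>L 'a) topology" where
  "ultrastrong_topology =
     seminorm_topology {\<lambda>a. sqrt (\<Sum>n. (norm (blinfun_apply a (x n)))\<^sup>2) | x. square_summable x}"

definition ultrastrong_star_topology :: "('a::complex_hilbert \<Rightarrow>\<^sub>L 'a) topology" where
  "ultrastrong_star_topology = seminorm_topology
     ({\<lambda>a. sqrt (\<Sum>n. (norm (blinfun_apply a (x n)))\<^sup>2) | x. square_summable x} \<union>
      {\<lambda>a. sqrt (\<Sum>n. (norm (blinfun_apply (adjoint_op a) (x n)))\<^sup>2) | x. square_summable x})"

definition arens_mackey_topology :: "('a::complex_hilbert \<Rightarrow>\<^sub>L 'a) topology" where
  "arens_mackey_topology = mackey_topology predual"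

definition weak_banach_topology :: "('a::complex_hilbert \<Rightarrow>\<^sub>L 'a) topology" where
  "weak_banach_topology = weak_topology norm_dual"

definition operator_norm_topology :: "('a::complex_hilbert \<Rightarrow>\<^sub>L 'a) topology" where
  "operator_norm_topology = top_of_set BH"

end

theory Submission
  imports Defs
begin

text \<open>The operator \<open>0\<close>, which is not doubly stochastic, is already a norm limit of convex
  combinations of permutation operators, and all nine topologies are coarser than the norm topology
  (for the Arens--Mackey topology this is the uniform boundedness principle).  To approximate \<open>0\<close>,
  take pairwise disjoint infinite sets \<open>U i\<close> and bijections \<open>\<rho> i\<close> of \<open>\<nat>\<close> mapping \<open>U i\<close> onto its
  complement.  Split the operator of \<open>\<rho> i\<close> into its restriction to the vectors supported on \<open>U i\<close>,
  and the rest, which has its range in the vectors supported on \<open>U i\<close>.  The former have orthogonal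
  supports and the latter orthogonal ranges, so each of the two sums over \<open>i < d\<close> has norm at most
  \<open>sqrt d\<close>, and the average of \<open>d\<close> permutation operators has norm at most \<open>2 / sqrt d\<close>.\<close>

subsection \<open>Complex inner product spaces\<close>

lemma scaleC_zero_right [simp]: "c *\<^sub>C (0::'a::complex_inner) = 0"
  using norm_scaleC[of c "0::'a"] by simp

lemma scaleC_scaleR: "c *\<^sub>C (r *\<^sub>R x) = r *\<^sub>R (c *\<^sub>C (x::'a::complex_inner))"
  by (metis scaleC_complex_of_real scaleC_scaleC mult.commute)

lemma bounded_linear_scaleC: "bounded_linear (\<lambda>x::'a::complex_inner. c *\<^sub>C x)"
  by (rule bounded_linear_intro[where K = "cmod c"])
    (simp_all add: scaleC_add_right scaleC_scaleR norm_scaleC)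

lemma cinner_add_right: "cinner x (y + z) = cinner x y + cinner x (z::'a::complex_inner)"
  by (metis cinner_add_left cinner_commute complex_cnj_add)

lemma cinner_scaleC_right: "cinner x (c *\<^sub>C y) = cnj c * cinner x (y::'a::complex_inner)"
  by (metis cinner_scaleC_left cinner_commute complex_cnj_mult)

text \<open>Multiplying \<open>x\<close> by the phase \<open>c\<close> that turns
  \<open>cinner x y\<close> into its modulus makes the form real, and the real Cauchy-Schwarz
  inequality applies; a phase does not change the norm.\<close>

lemma cmod_cinner_le: "cmod (cinner x y) \<le> norm x * norm (y::'a::complex_inner)"
proof (cases "cinner x y = 0")
  case False
  define c where "c = cnj (sgn (cinner x y))"
  have c: "cmod c = 1"
    using False by (simp add: c_def norm_sgn)
  have "c * cinner x y = cmod (cinner x y)"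
    using False complex_norm_square[of "cinner x y"]
    by (simp add: c_def sgn_eq field_simps power2_eq_square)
  then have "cmod (cinner x y) = inner (c *\<^sub>C x) y"
    by (metis Re_cinner Re_complex_of_real cinner_scaleC_left)
  also have "\<dots> \<le> norm (c *\<^sub>C x) * norm y"
    by (rule norm_cauchy_schwarz)
  finally show ?thesis
    by (simp add: norm_scaleC c)
qed simp

lemma cmod_cinner_blinfun_le:
  "cmod (cinner (blinfun_apply a x) y) \<le> norm a * norm x * norm (y::'a::complex_inner)"
  by (rule order_trans[OF cmod_cinner_le mult_right_mono[OF norm_blinfun norm_ge_zero]])

lemma bounded_linear_cinner_left: "bounded_linear (\<lambda>x. cinner x (y::'a::complex_inner))"
proof (rule bounded_linear_intro)
  fix r and x :: 'a
  show "cinner (r *\<^sub>R x) y = r *\<^sub>R cinner x y"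
    by (metis cinner_scaleC_left scaleC_complex_of_real scaleR_conv_of_real)
  show "cmod (cinner x y) \<le> norm x * norm y"
    by (rule cmod_cinner_le)
qed (simp_all add: cinner_add_left)

text \<open>Conjugation fixes real scalars, so the form is real-linear even in its conjugate-linear
  argument.\<close>

lemma bounded_linear_cinner_right: "bounded_linear (\<lambda>y. cinner (x::'a::complex_inner) y)"
proof (rule bounded_linear_intro)
  fix r and y :: 'a
  show "cinner x (r *\<^sub>R y) = r *\<^sub>R cinner x y"
    by (metis cinner_scaleC_right scaleC_complex_of_real scaleR_conv_of_real complex_cnj_complex_of_real)
  show "cmod (cinner x y) \<le> norm y * norm x" 
    using cmod_cinner_le[of x y] by (simp add: mult.commute)
qed (simp_all add: cinner_add_right)

lemmas cinner_sum_left = linear_sum[OF bounded_linear.linear[OF bounded_linear_cinner_left]]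
lemmas cinner_sum_right = linear_sum[OF bounded_linear.linear[OF bounded_linear_cinner_right]]
lemmas cinner_diff_left = linear_diff[OF bounded_linear.linear[OF bounded_linear_cinner_left]]
lemmas cinner_zero_left = linear_0[OF bounded_linear.linear[OF bounded_linear_cinner_left]]

section \<open>Unconditional sums, and bijections of infinite sets onto their complements\<close>

lemma has_sum_finite_sum:
  fixes f :: "'i \<Rightarrow> 'x \<Rightarrow> 'b::topological_comm_monoid_add"
  assumes "\<And>i. (f i has_sum s i) A"
  shows "((\<lambda>x. \<Sum>i\<in>I. f i x) has_sum (\<Sum>i\<in>I. s i)) A"
  by (induction I rule: infinite_finite_induct) (auto intro: has_sum_add assms)

text \<open>A pairing function arranges the naturals in infinitely many infinite columns
  \<open>U i\<close>. Each column and its complement are countably infinite, hence in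
  bijection.\<close>

lemma ex_bijections_to_complement:
  "\<exists>(U :: nat \<Rightarrow> nat set) \<rho>. (\<forall>i. bij (\<rho> i)) \<and> disjoint_family U \<and> (\<forall>i. \<rho> i ` U i = - U i)"
proof -
  define U where "U i = range (\<lambda>k. prod_encode (i, k))" for i :: nat
  have disj: "disjoint_family U"
    by (auto simp: disjoint_family_on_def U_def)
  have "\<exists>f. bij f \<and> f ` U i = - U i" for i
  proof -
    have inf: "infinite (U j)" for j
      unfolding U_def by (rule range_inj_infinite) (simp add: inj_def)
    \<comment> \<open>One neighbouring column already makes the complement infinite.\<close>
    have "U (Suc i) \<subseteq> - U i"
      by (auto simp: U_def)
    then have infc: "infinite (- U i)"
      using inf infinite_super by blast
    obtain f where f: "bij_betw f (U i) (- U i)"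
      using inf infc
      by (metis bij_betw_from_nat_into bij_betw_inv bij_betw_trans countableI_type countable_subset subset_UNIV)
    \<comment> \<open>Gluing \<open>f\<close> with its inverse gives an involution that exchanges
      \<open>U i\<close> and its complement.\<close>
    let ?h = "\<lambda>x. if x \<in> U i then f x else inv_into (U i) f x"
    have "bij_betw ?h (U i \<union> - U i) (- U i \<union> U i)"
      using f bij_betw_inv_into[OF f] by (intro bij_betw_disjoint_Un) auto
    moreover have "?h ` U i = - U i"
      using f by (simp add: bij_betw_def)
    ultimately show ?thesis
      by (intro exI[of _ ?h]) (simp add: Un_commute)
  qed
  then obtain \<rho> where "\<And>i. bij (\<rho> i) \<and> \<rho> i ` U i = - U i"
    by metis
  then show ?thesis using disj by blast
qed

lemma subspace_BH: "subspace (BH :: ('a::complex_hilbert \<Rightarrow>\<^sub>L 'a) set)"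
  by (simp add: subspace_def BH_def blinfun.add_left blinfun.scaleR_left scaleC_add_right scaleC_scaleR)

lemma scaleC_op_in_BH: "a \<in> BH \<Longrightarrow> scaleC_op c a \<in> BH"
  by (simp add: BH_def scaleC_op_apply scaleC_scaleC mult.commute)

lemmas BH_add = subspace_add[OF subspace_BH]


subsection \<open>Expansion in an orthonormal basis\<close>

locale orthonormal_basis =
  fixes e :: "nat \<Rightarrow> 'a::complex_hilbert"
  assumes basis: "is_orthonormal_basis e"
begin

lemma cinner_basis: "cinner (e m) (e n) = (if m = n then 1 else 0)"
  using basis by (simp add: is_orthonormal_basis_def)

lemma norm_sum_basis: "finite A \<Longrightarrow> (norm (\<Sum>n\<in>A. c n *\<^sub>C e n))\<^sup>2 = (\<Sum>n\<in>A. (cmod (c n))\<^sup>2)"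
proof -
  assume A: "finite A"
  have "complex_of_real ((norm (\<Sum>n\<in>A. c n *\<^sub>C e n))\<^sup>2)
      = (\<Sum>m\<in>A. \<Sum>n\<in>A. if n = m then cnj (c m) * c n else 0)"
    unfolding cinner_self[symmetric]
    by (simp add: cinner_sum_left cinner_sum_right cinner_scaleC_left cinner_scaleC_right cinner_basis
        sum_distrib_left if_distrib[of "(*) _"] cong: if_cong)
  also have "\<dots> = (\<Sum>n\<in>A. complex_of_real ((cmod (c n))\<^sup>2))"
    using A by (simp add: mult.commute complex_norm_square[symmetric] del: of_real_power)
  finally show ?thesis
    by (simp only: of_real_sum[symmetric] of_real_eq_iff)
qed

abbreviation coef :: "'a \<Rightarrow> nat \<Rightarrow> complex" where
  "coef x n \<equiv> cinner x (e n)"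

definition fourier_sum :: "nat \<Rightarrow> 'a \<Rightarrow> 'a" where
  "fourier_sum N x = (\<Sum>n<N. coef x n *\<^sub>C e n)"

lemma norm_fourier_sum: "(norm (fourier_sum N x))\<^sup>2 = (\<Sum>n<N. (cmod (coef x n))\<^sup>2)"
  by (simp add: fourier_sum_def norm_sum_basis)

text \<open>Pythagoras, because the partial sum is the orthogonal projection of \<open>x\<close>. It
  follows that passing to the remainder never increases the norm.\<close>

lemma fourier_remainder:
  "(norm (x - fourier_sum N x))\<^sup>2 = (norm x)\<^sup>2 - (norm (fourier_sum N x))\<^sup>2"
proof -
  have "cinner x (fourier_sum N x) = (\<Sum>n<N. complex_of_real ((cmod (coef x n))\<^sup>2))"
    by (simp add: fourier_sum_def cinner_sum_right cinner_scaleC_right mult.commute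
        complex_norm_square[symmetric] del: of_real_power)
  then have "inner x (fourier_sum N x) = (norm (fourier_sum N x))\<^sup>2"
    by (simp add: Re_cinner[symmetric] norm_fourier_sum)
  then show ?thesis
    by (simp add: power2_norm_eq_inner inner_diff_left inner_diff_right inner_commute)
qed

lemma fourier_sum_diff: "fourier_sum N (x - y) = fourier_sum N x - fourier_sum N y"
  unfolding fourier_sum_def sum_subtractf[symmetric]
  by (intro sum.cong refl)
    (metis (no_types, lifting) cinner_diff_left add_diff_cancel eq_diff_eq scaleC_add_left)

lemma fourier_sum_span:
  assumes "y \<in> module.span scaleC (range e)"
  shows "\<exists>M. \<forall>N\<ge>M. fourier_sum N y = y"
proof -
  interpret vector_space "scaleC :: complex \<Rightarrow> 'a \<Rightarrow> 'a"
    by (rule vector_space_scaleC)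
  show ?thesis
    using assms
  proof (induction rule: span_induct_alt)
    case base
    show ?case by (simp add: fourier_sum_def cinner_zero_left)
  next
    case (step c x y)
    then obtain n M where x: "x = e n" and M: "\<And>N. N \<ge> M \<Longrightarrow> fourier_sum N y = y"
      by auto
    \<comment> \<open>The partial sum runs over indices below \<open>N\<close>, so
      \<open>e n\<close> is captured only from \<open>Suc n\<close> on.\<close>
    have "fourier_sum N (c *\<^sub>C x + y) = c *\<^sub>C x + y" if "N \<ge> max M (Suc n)" for N
    proof -
      have "fourier_sum N (c *\<^sub>C x + y) = (\<Sum>k<N. if n = k then c *\<^sub>C e n else 0) + fourier_sum N y"
        unfolding fourier_sum_def sum.distrib[symmetric]
        by (intro sum.cong) (auto simp: x cinner_add_left cinner_scaleC_left cinner_basis scaleC_add_left)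
      then show ?thesis
        using that M by (simp add: x)
    qed
    then show ?case by blast
  qed
qed

text \<open>Choose \<open>y\<close> in the dense span close to \<open>x\<close>. For large
  \<open>N\<close> the remainder of \<open>y\<close> vanishes, so the remainder of \<open>x\<close>
  is that of \<open>x - y\<close>, whose norm is at most that of \<open>x - y\<close>.\<close>

lemma fourier_expansion: "(\<lambda>n. coef x n *\<^sub>C e n) sums x"
  unfolding sums_def LIMSEQ_iff
proof (intro allI impI)
  fix r :: real assume "r > 0"
  moreover have "x \<in> closure (module.span scaleC (range e))"
    using basis by (simp add: is_orthonormal_basis_def)
  ultimately obtain y where y: "y \<in> module.span scaleC (range e)" "norm (x - y) < r"
    by (metis closure_approachable dist_commute dist_norm)
  obtain M where M: "\<And>N. N \<ge> M \<Longrightarrow> fourier_sum N y = y"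
    using fourier_sum_span[OF y(1)] by blast
  have "norm ((\<Sum>n<N. coef x n *\<^sub>C e n) - x) < r" if "N \<ge> M" for N
  proof -
    have "norm (x - fourier_sum N x) = norm ((x - y) - fourier_sum N (x - y))"
      by (simp add: fourier_sum_diff M[OF that])
    also have "\<dots> \<le> norm (x - y)"
      by (rule power2_le_imp_le) (simp_all add: fourier_remainder)
    finally show ?thesis
      using y(2) by (simp add: fourier_sum_def norm_minus_commute)
  qed
  then show "\<exists>M. \<forall>N\<ge>M. norm ((\<Sum>n<N. coef x n *\<^sub>C e n) - x) < r"
    by blast
qed

text \<open>Stated with the unconditional \<open>has_sum\<close>, so that the coefficients may later
  be reindexed by an arbitrary permutation.\<close>

lemma parseval: "((\<lambda>n. (cmod (coef x n))\<^sup>2) has_sum (norm x)\<^sup>2) UNIV"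
proof (rule sums_nonneg_imp_has_sum)
  have "(\<lambda>N. (norm (\<Sum>n<N. coef x n *\<^sub>C e n))\<^sup>2) \<longlonglongrightarrow> (norm x)\<^sup>2"
    using fourier_expansion by (intro tendsto_intros) (simp add: sums_def)
  then show "(\<lambda>n. (cmod (coef x n))\<^sup>2) sums (norm x)\<^sup>2"
    by (simp add: sums_def norm_sum_basis)
qed simp

lemma coef_eqI:
  assumes "\<And>n. coef x n = coef y n"
  shows "x = y"
  using fourier_expansion[of x] fourier_expansion[of y] sums_unique2 assms by simp

text \<open>By Pythagoras the squared norm of a block of the vector series is a block of the given
  scalar series, so the vector series is Cauchy. Pairing its limit with \<open>e m\<close> recovers
  \<open>c m\<close>.\<close>

lemma riesz_fischer:
  assumes "summable (\<lambda>n. (cmod (c n))\<^sup>2)"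
  shows "\<exists>x. \<forall>n. coef x n = c n"
proof -
  have "summable (\<lambda>n. c n *\<^sub>C e n)"
    unfolding summable_Cauchy
  proof (intro allI impI)
    fix r :: real assume "r > 0"
    then obtain N where N: "\<And>m n. m \<ge> N \<Longrightarrow> norm (\<Sum>k=m..<n. (cmod (c k))\<^sup>2) < r\<^sup>2"
      using assms[unfolded summable_Cauchy] by (meson zero_less_power)
    have "norm (\<Sum>k=m..<n. c k *\<^sub>C e k) < r" if "m \<ge> N" for m n
    proof (rule power2_less_imp_less)
      show "(norm (\<Sum>k=m..<n. c k *\<^sub>C e k))\<^sup>2 < r\<^sup>2"
        using N[OF that, of n] by (simp add: norm_sum_basis)
    qed (use \<open>r > 0\<close> in simp)
    then show "\<exists>N. \<forall>m\<ge>N. \<forall>n. norm (\<Sum>k=m..<n. c k *\<^sub>C e k) < r"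
      by blast
  qed
  then have "(\<lambda>n. if n = m then c n else 0) sums coef (\<Sum>n. c n *\<^sub>C e n) m" for m
    using bounded_linear.sums[OF bounded_linear_cinner_left summable_sums, of _ "e m"]
    by (force simp: cinner_scaleC_left cinner_basis if_distrib[of "(*) _"] cong: if_cong)
  then have "coef (\<Sum>n. c n *\<^sub>C e n) m = c m" for m
    using sums_single sums_unique2 by blast
  then show ?thesis by blast
qed

lemma bounded_functional_eqI:
  assumes "bounded_linear f" "bounded_linear g"
    and "\<And>c x. f (c *\<^sub>C x) = c * f x" "\<And>c x. g (c *\<^sub>C x) = c * g x"
    and "\<And>n. f (e n) = g (e n)"
  shows "f x = g x"
  using bounded_linear.sums[OF assms(1) fourier_expansion[of x]]
    bounded_linear.sums[OF assms(2) fourier_expansion[of x]] assms(3-5) sums_unique2 by simp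

text \<open>Permutation operators and adjoints are first obtained as mere functions, known through
  their coefficients; this turns such a function into an element of \<open>BH\<close>.\<close>

lemma BH_intro:
  assumes add: "\<And>x y. f (x + y) = f x + f y"
    and scale: "\<And>c x. f (c *\<^sub>C x) = c *\<^sub>C f x"
    and bound: "\<And>x. norm (f x) \<le> K * norm x"
  shows "\<exists>a\<in>BH. \<forall>x. blinfun_apply a x = (f x :: 'a)"
proof -
  have "bounded_linear f"
  proof (rule bounded_linear_intro)
    show "f (r *\<^sub>R x) = r *\<^sub>R f x" for r x
      by (metis scale scaleC_complex_of_real)
    show "norm (f x) \<le> norm x * K" for x
      using bound by (simp add: mult.commute)
  qed (rule add)
  then show ?thesis
    by (intro bexI[of _ "Blinfun f"]) (simp_all add: bounded_linear_Blinfun_apply BH_def scale)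
qed

lemma BH_scaleC: "a \<in> BH \<Longrightarrow> blinfun_apply a (c *\<^sub>C x) = c *\<^sub>C blinfun_apply a x"
  by (simp add: BH_def)

lemma bounded_linear_cinner_blinfun: "bounded_linear (\<lambda>x. cinner (blinfun_apply a x) y)"
  by (rule bounded_linear_compose[OF bounded_linear_cinner_left blinfun.bounded_linear_right])

lemma BH_eqI:
  assumes "a \<in> BH" "b \<in> BH" and "\<And>n. blinfun_apply a (e n) = blinfun_apply b (e n)"
  shows "a = b"
proof (intro blinfun_eqI coef_eqI)
  show "coef (blinfun_apply a x) n = coef (blinfun_apply b x) n" for x n
    by (rule bounded_functional_eqI[OF bounded_linear_cinner_blinfun bounded_linear_cinner_blinfun])
      (simp_all add: assms BH_scaleC cinner_scaleC_left)
qed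


subsection \<open>Permutation operators\<close>

text \<open>\<open>perm_op\<close> is a definite description, so an operator must be constructed and
  shown unique. Permuting the coefficients of \<open>x\<close> gives a square summable family, hence
  a vector by \<open>riesz_fischer\<close>; reindexing in \<open>parseval\<close> shows that the
  norm is preserved. Uniqueness is \<open>BH_eqI\<close>.\<close>

lemma
  assumes "bij \<rho>"
  shows perm_op_in_BH: "perm_op e \<rho> \<in> BH"
    and coef_perm_op: "coef (blinfun_apply (perm_op e \<rho>) x) n = coef x (inv \<rho> n)"
proof -
  have sum: "((\<lambda>n. (cmod (coef x (inv \<rho> n)))\<^sup>2) has_sum (norm x)\<^sup>2) UNIV" for x
    using has_sum_reindex_bij_betw[OF bij_imp_bij_inv[OF assms], of "\<lambda>n. (cmod (coef x n))\<^sup>2"]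
    by (simp add: parseval)
  have "\<forall>x. \<exists>y. \<forall>n. coef y n = coef x (inv \<rho> n)"
    by (intro allI riesz_fischer sums_summable[OF has_sum_imp_sums[OF sum]])
  then obtain f where f: "\<And>x n. coef (f x) n = coef x (inv \<rho> n)"
    by metis
  have "\<exists>u\<in>BH. \<forall>x. blinfun_apply u x = f x"
  proof (rule BH_intro)
    show "norm (f x) \<le> 1 * norm x" for x
      using has_sum_unique[OF sum[of x] parseval[of "f x", unfolded f]] by simp
  qed (rule coef_eqI, simp add: f cinner_add_left cinner_scaleC_left)+
  then obtain u where u: "u \<in> BH" "\<And>x. blinfun_apply u x = f x"
    by blast
  have ue: "blinfun_apply u (e n) = e (\<rho> n)" for n
    by (rule coef_eqI) (use assms in \<open>auto simp: u f cinner_basis bij_inv_eq_iff\<close>)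
  have "perm_op e \<rho> = u"
    unfolding perm_op_def using u(1) ue by (intro the_equality) (auto intro!: BH_eqI)
  then show "perm_op e \<rho> \<in> BH" "coef (blinfun_apply (perm_op e \<rho>) x) n = coef x (inv \<rho> n)"
    by (simp_all add: u f)
qed


subsection \<open>Adjoints\<close>

text \<open>The adjoint must send \<open>y\<close> to the vector with coefficients
  \<open>cinner y (a (e n))\<close>. A Bessel-type bound on these makes \<open>riesz_fischer\<close>
  applicable and also bounds the norm of the result.\<close>

lemma
  fixes a :: "'a \<Rightarrow>\<^sub>L 'a"
  assumes "a \<in> BH"
  shows adjoint_op_in_BH: "adjoint_op a \<in> BH"
    and cinner_adjoint_op: "cinner (blinfun_apply a x) y = cinner x (blinfun_apply (adjoint_op a) y)"
    and norm_adjoint_op_apply_le: "norm (blinfun_apply (adjoint_op a) x) \<le> norm a * norm x"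
proof -
  define c where "c y n = cinner y (blinfun_apply a (e n))" for y n
  have bound: "(\<Sum>n<N. (cmod (c y n))\<^sup>2) \<le> (norm a * norm y)\<^sup>2" for y N
  proof -
    define s where "s = norm (\<Sum>n<N. c y n *\<^sub>C e n)"
    have s2: "s\<^sup>2 = (\<Sum>n<N. (cmod (c y n))\<^sup>2)"
      by (simp add: s_def norm_sum_basis)
    \<comment> \<open>Testing against the vector with the coefficients \<open>c y n\<close>
      themselves reproduces their sum of squares, so one factor \<open>s\<close> can be cancelled
      afterwards.\<close>
    have "cinner y (blinfun_apply a (\<Sum>n<N. c y n *\<^sub>C e n)) = complex_of_real (s\<^sup>2)"
      by (simp add: s2 blinfun.sum_right BH_scaleC[OF assms] cinner_sum_right cinner_scaleC_right
          c_def[symmetric] mult.commute complex_norm_square[symmetric] del: of_real_power)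
    then have "s\<^sup>2 \<le> norm y * norm (blinfun_apply a (\<Sum>n<N. c y n *\<^sub>C e n))"
      by (metis cmod_cinner_le norm_of_real abs_of_nonneg zero_le_power2)
    also have "\<dots> \<le> norm y * (norm a * s)"
      unfolding s_def by (intro mult_left_mono norm_blinfun) simp
    finally have "s * s \<le> (norm a * norm y) * s"
      by (simp add: power2_eq_square mult_ac)
    then have "s \<le> norm a * norm y"
      by (cases "s = 0") (auto simp: s_def mult_le_cancel_right)
    then show ?thesis
      unfolding s2[symmetric] by (intro power_mono) (simp_all add: s_def)
  qed
  have summable: "summable (\<lambda>n. (cmod (c y n))\<^sup>2)" for y
    by (rule summableI_nonneg_bounded[OF _ bound]) simp
  then have "\<forall>y. \<exists>z. \<forall>n. coef z n = c y n"
    using riesz_fischer by blast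
  then obtain f where f: "\<And>y n. coef (f y) n = c y n"
    by metis
  have bound_f: "norm (f y) \<le> norm a * norm y" for y
  proof (rule power2_le_imp_le)
    have "(norm (f y))\<^sup>2 = (\<Sum>n. (cmod (c y n))\<^sup>2)"
      using has_sum_imp_sums[OF parseval[of "f y"]] by (simp add: f sums_iff)
    also have "\<dots> \<le> (norm a * norm y)\<^sup>2"
      by (rule suminf_le_const[OF summable bound])
    finally show "(norm (f y))\<^sup>2 \<le> (norm a * norm y)\<^sup>2" .
  qed simp
  have "\<exists>b\<in>BH. \<forall>x. blinfun_apply b x = f x"
  proof (rule BH_intro)
    show "norm (f y) \<le> norm a * norm y" for y
      by (rule bound_f)
  qed (rule coef_eqI, simp add: f c_def cinner_add_left cinner_scaleC_left)+
  then obtain b where b: "b \<in> BH" "\<And>x. blinfun_apply b x = f x"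
    by blast
  have adj: "cinner (blinfun_apply a x) y = cinner x (blinfun_apply b y)" for x y
  proof (rule bounded_functional_eqI[OF bounded_linear_cinner_blinfun bounded_linear_cinner_left])
    show "cinner (blinfun_apply a (e n)) y = cinner (e n) (blinfun_apply b y)" for n
      using f[of y n] by (metis b(2) c_def cinner_commute)
  qed (simp_all add: BH_scaleC[OF assms] cinner_scaleC_left)
  have "adjoint_op a = b"
    unfolding adjoint_op_def
  \<comment> \<open>Uniqueness: the adjoint identity, tested on basis vectors, fixes every
    coefficient of \<open>b' y\<close>.\<close>
  proof (rule the_equality)
    fix b' assume b': "b' \<in> BH \<and> (\<forall>x y. cinner (blinfun_apply a x) y = cinner x (blinfun_apply b' y))"
    show "b' = b"
    proof (intro blinfun_eqI coef_eqI)
      fix y n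
      show "coef (blinfun_apply b' y) n = coef (blinfun_apply b y) n"
        using b' adj by (metis cinner_commute)
    qed
  qed (use b adj in blast)
  then show "adjoint_op a \<in> BH" "cinner (blinfun_apply a x) y = cinner x (blinfun_apply (adjoint_op a) y)"
    using b adj by auto
  show "norm (blinfun_apply (adjoint_op a) x) \<le> norm a * norm x"
    using bound_f \<open>adjoint_op a = b\<close> b(2) by simp
qed

lemma adjoint_op_add:
  fixes a b :: "'a \<Rightarrow>\<^sub>L 'a"
  assumes "a \<in> BH" "b \<in> BH"
  shows "blinfun_apply (adjoint_op (a + b)) x = blinfun_apply (adjoint_op a) x + blinfun_apply (adjoint_op b) x"
proof (rule coef_eqI)
  fix n
  have "cinner (e n) (blinfun_apply (adjoint_op (a + b)) x)
      = cinner (e n) (blinfun_apply (adjoint_op a) x + blinfun_apply (adjoint_op b) x)"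
    using assms by (simp add: cinner_adjoint_op[symmetric] BH_add blinfun.add_left cinner_add_left cinner_add_right)
  then show "coef (blinfun_apply (adjoint_op (a + b)) x) n
      = coef (blinfun_apply (adjoint_op a) x + blinfun_apply (adjoint_op b) x) n"
    by (metis cinner_commute)
qed


subsection \<open>Norms of sums of permutation operators\<close>

lemma norm_sum_perm_op_le:
  assumes bij: "\<And>i. bij (\<rho> i)" and U: "disjoint_family U"
    and image: "\<And>i. \<rho> i ` U i = - U i"
  shows "norm (\<Sum>i<d. perm_op e (\<rho> i)) \<le> 2 * sqrt (real d)"
proof (rule norm_blinfun_bound)
  fix x
  let ?y = "blinfun_apply (\<Sum>i<d. perm_op e (\<rho> i)) x"
  define g where "g i m = cmod (coef x (inv (\<rho> i) m))" for i m
  \<comment> \<open>\<open>w i\<close> is the part of the squared coefficients of \<open>x\<close>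
    that sits on \<open>U i\<close>, and \<open>s i\<close> below is its total. Disjointness bounds
    the sum of these totals by the squared norm of \<open>x\<close>.\<close>
  define w where "w i n = (if n \<in> U i then (cmod (coef x n))\<^sup>2 else 0)" for i n
  have bij_inv: "bij (inv (\<rho> i))" for i
    by (rule bij_imp_bij_inv[OF bij])
  have inv_in: "inv (\<rho> i) m \<in> U i \<longleftrightarrow> m \<notin> U i" for i m
    using image[of i] bij[of i]
    by (metis (no_types, lifting) ComplD ComplI bij_is_inj bij_is_surj imageE image_eqI inv_f_f surj_f_inv_f)
  have total: "((\<lambda>m. (g i m)\<^sup>2) has_sum (norm x)\<^sup>2) UNIV" for i
    unfolding g_def using has_sum_reindex_bij_betw[OF bij_inv, of "\<lambda>n. (cmod (coef x n))\<^sup>2"]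
    by (simp add: parseval)
  have w_summable: "w i summable_on UNIV" for i
    by (rule summable_on_comparison_test[OF has_sum_imp_summable[OF parseval[of x]]]) (auto simp: w_def)
  define s where "s i = infsum (w i) UNIV" for i
  have w_sum: "(w i has_sum s i) UNIV" for i
    unfolding s_def using w_summable by simp
  then have w_inv: "((\<lambda>m. w i (inv (\<rho> i) m)) has_sum s i) UNIV" for i
    using has_sum_reindex_bij_betw[OF bij_inv, of "w i"] by simp
  have s_le: "(\<Sum>i<d. s i) \<le> (norm x)\<^sup>2"
  proof (rule has_sum_mono[OF has_sum_finite_sum[OF w_sum] parseval[of x]])
    show "(\<Sum>i<d. w i n) \<le> (cmod (coef x n))\<^sup>2" for n
    proof (cases "\<exists>j<d. n \<in> U j")
      case True
      then obtain j where j: "j < d" "n \<in> U j" by blast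
      then have "w i n = (if i = j then (cmod (coef x n))\<^sup>2 else 0)" for i
        using U by (auto simp: w_def disjoint_family_on_def)
      then show ?thesis by simp
    qed (simp add: w_def)
  qed
  have pointwise: "(cmod (coef ?y m))\<^sup>2
      \<le> 2 * (\<Sum>i<d. (g i m)\<^sup>2) + 2 * real d * (\<Sum>i<d. w i (inv (\<rho> i) m))" for m
  proof -
    \<comment> \<open>The disjointness of the \<open>U i\<close> leaves at most one index in \<open>A\<close>, and on \<open>B\<close> the sum over \<open>m\<close>
      of the squares is controlled by \<open>w_inv\<close> and \<open>s_le\<close>.\<close>
    define A where "A = {i. i < d \<and> m \<in> U i}"
    define B where "B = {i. i < d \<and> m \<notin> U i}"
    have AB: "{..<d} = A \<union> B" "A \<inter> B = {}" "finite A" "finite B"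
      by (auto simp: A_def B_def)
    have "card A \<le> 1"
      using U AB(3) by (auto simp: card_le_Suc0_iff_eq A_def disjoint_family_on_def)
    have "card B \<le> d"
      using card_mono[of "{..<d}" B] by (auto simp: B_def)
    have "(\<Sum>i\<in>A. g i m)\<^sup>2 \<le> (\<Sum>i\<in>A. (g i m)\<^sup>2) * card A"
      by (rule sum_squared_le_sum_of_squares)
    also have "\<dots> \<le> (\<Sum>i\<in>A. (g i m)\<^sup>2) * 1"
      using \<open>card A \<le> 1\<close> by (intro mult_left_mono sum_nonneg) auto
    also have "\<dots> \<le> (\<Sum>i<d. (g i m)\<^sup>2)"
      using AB by (auto intro!: sum_mono2)
    finally have A: "(\<Sum>i\<in>A. g i m)\<^sup>2 \<le> (\<Sum>i<d. (g i m)\<^sup>2)" .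
    have "(\<Sum>i\<in>B. g i m)\<^sup>2 \<le> (\<Sum>i\<in>B. (g i m)\<^sup>2) * card B"
      by (rule sum_squared_le_sum_of_squares)
    also have "\<dots> \<le> (\<Sum>i\<in>B. (g i m)\<^sup>2) * d"
      using \<open>card B \<le> d\<close> by (intro mult_left_mono sum_nonneg) auto
    \<comment> \<open>For \<open>i\<close> in \<open>B\<close> the preimage of \<open>m\<close> lies
      in \<open>U i\<close>, where \<open>w i\<close> is the full squared coefficient.\<close>
    also have "(\<Sum>i\<in>B. (g i m)\<^sup>2) = (\<Sum>i\<in>B. w i (inv (\<rho> i) m))"
      by (rule sum.cong) (auto simp: B_def w_def g_def inv_in)
    also have "\<dots> * d \<le> (\<Sum>i<d. w i (inv (\<rho> i) m)) * d"
      using AB by (intro mult_right_mono sum_mono2) (auto simp: w_def)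
    finally have B: "(\<Sum>i\<in>B. g i m)\<^sup>2 \<le> (\<Sum>i<d. w i (inv (\<rho> i) m)) * d" .
    have "cmod (coef ?y m) \<le> (\<Sum>i<d. g i m)"
      by (simp add: blinfun.sum_left cinner_sum_left coef_perm_op[OF bij] g_def sum_norm_le)
    also have "\<dots> = (\<Sum>i\<in>A. g i m) + (\<Sum>i\<in>B. g i m)"
      unfolding AB(1) using AB by (intro sum.union_disjoint) auto
    finally have "(cmod (coef ?y m))\<^sup>2 \<le> ((\<Sum>i\<in>A. g i m) + (\<Sum>i\<in>B. g i m))\<^sup>2"
      by (intro power_mono) auto
    \<comment> \<open>The cross term is absorbed by the sum of the two squares, at the cost of a
      factor 2.\<close>
    also have "\<dots> \<le> 2 * (\<Sum>i\<in>A. g i m)\<^sup>2 + 2 * (\<Sum>i\<in>B. g i m)\<^sup>2"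
      using sum_squares_bound[of "\<Sum>i\<in>A. g i m" "\<Sum>i\<in>B. g i m"] by (simp add: power2_sum)
    also have "\<dots> \<le> 2 * (\<Sum>i<d. (g i m)\<^sup>2) + 2 * ((\<Sum>i<d. w i (inv (\<rho> i) m)) * d)"
      by (intro add_mono mult_left_mono A B) auto
    finally show ?thesis
      by (simp add: mult_ac)
  qed
  \<comment> \<open>Summing over \<open>m\<close>, each of the two parts contributes at most
    \<open>2 * d\<close> times the squared norm of \<open>x\<close>; the total \<open>4 * d\<close>
    is the square of \<open>2 * sqrt d\<close>.\<close>
  have "(norm ?y)\<^sup>2 \<le> 2 * (\<Sum>i<d. (norm x)\<^sup>2) + 2 * real d * (\<Sum>i<d. s i)"
    by (rule has_sum_mono[OF parseval has_sum_add[OF has_sum_cmult_right[OF has_sum_finite_sum[OF total]]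
            has_sum_cmult_right[OF has_sum_finite_sum[OF w_inv]]]]) (use pointwise in simp_all)
  also have "\<dots> \<le> 2 * (\<Sum>i<d. (norm x)\<^sup>2) + 2 * real d * (norm x)\<^sup>2"
    using s_le by (intro add_left_mono mult_left_mono) auto
  also have "\<dots> = (2 * sqrt (real d) * norm x)\<^sup>2"
    by (simp add: power_mult_distrib)
  finally show "norm ?y \<le> 2 * sqrt (real d) * norm x"
    by (rule power2_le_imp_le) simp
qed simp

lemma zero_limit_of_perm_ops:
  assumes "r > 0"
  shows "\<exists>b \<in> convex hull (perm_op e ` {\<rho>. bij \<rho>}). b \<in> BH \<and> norm b < r"
proof -
  obtain U :: "nat \<Rightarrow> nat set" and \<rho>
    where \<rho>: "\<And>i. bij (\<rho> i)" "disjoint_family U" "\<And>i. \<rho> i ` U i = - U i"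
    using ex_bijections_to_complement by blast
  \<comment> \<open>This choice is equivalent to \<open>2 / sqrt d < r\<close>, the left side being
    the bound for an average with equal weights.\<close>
  obtain d :: nat where d: "real d > 4 / r\<^sup>2"
    using reals_Archimedean2 by blast
  have "0 < 4 / r\<^sup>2"
    using assms by simp
  with d have "d > 0"
    by (metis gr0I less_asym of_nat_0)
  define b where "b = (\<Sum>i<d. (1 / real d) *\<^sub>R perm_op e (\<rho> i))"
  have "b \<in> convex hull (perm_op e ` {\<rho>. bij \<rho>})"
    unfolding b_def using \<open>d > 0\<close> \<rho>(1)
    by (intro convex_sum) (auto intro!: hull_inc)
  moreover have "b \<in> BH"
    unfolding b_def using perm_op_in_BH[OF \<rho>(1)]
    by (intro subspace_sum subspace_scale subspace_BH)
  moreover have "norm b < r"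
  proof -
    have "norm b = norm (\<Sum>i<d. perm_op e (\<rho> i)) / real d"
      by (simp add: b_def scaleR_sum_right[symmetric])
    also have "\<dots> \<le> 2 * sqrt (real d) / real d"
      by (intro divide_right_mono norm_sum_perm_op_le[OF \<rho>]) simp
    also have "\<dots> = 2 / sqrt (real d)"
      using \<open>d > 0\<close> by (simp add: field_simps)
    also have "\<dots> < r"
    proof -
      have "2 / r < sqrt (real d)"
        using d by (intro real_less_rsqrt) (simp add: power_divide)
      then show ?thesis
        using assms \<open>d > 0\<close> by (simp add: field_simps)
    qed
    finally show ?thesis .
  qed
  ultimately show ?thesis by blast
qed

end


subsection \<open>Uniform boundedness\<close>

text \<open>Banach-Steinhaus by the Baire category theorem. It is relative to a closed real subspace
  because it will be applied to \<open>BH\<close>, which is a set of operators and not a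
  type.\<close>

lemma uniform_boundedness:
  fixes S :: "'b::banach set" and K :: "('b \<Rightarrow> 'c::real_normed_vector) set"
  assumes S: "closed S" "subspace S"
    and cont: "\<And>f. f \<in> K \<Longrightarrow> continuous_on S f"
    and add: "\<And>f x y. f \<in> K \<Longrightarrow> x \<in> S \<Longrightarrow> y \<in> S \<Longrightarrow> f (x + y) = f x + f y"
    and scale: "\<And>f x r. f \<in> K \<Longrightarrow> x \<in> S \<Longrightarrow> f (r *\<^sub>R x) = r *\<^sub>R f x"
    and pointwise: "\<And>x. x \<in> S \<Longrightarrow> \<exists>B. \<forall>f\<in>K. norm (f x) \<le> B"
  shows "\<exists>C. \<forall>f\<in>K. \<forall>x\<in>S. norm (f x) \<le> C * norm x"
proof -
  define A where "A n = {x \<in> S. \<forall>f\<in>K. norm (f x) \<le> real n}" for n :: nat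
  have closed: "closedin (top_of_set S) (A n)" for n
  proof -
    \<comment> \<open>The outer \<open>S\<close> matters for empty \<open>K\<close>, where the
      intersection over \<open>K\<close> is the whole space.\<close>
    have "A n = S \<inter> (\<Inter>f\<in>K. {x \<in> S. norm (f x) \<le> real n})"
      by (auto simp: A_def)
    moreover have "closedin (top_of_set S) {x \<in> S. norm (f x) \<le> real n}" if "f \<in> K" for f
      using continuous_closedin_preimage[OF cont[OF that] closed_cball[of 0 "real n"]]
      by (simp add: vimage_def Int_def dist_norm)
    ultimately show ?thesis
      by (cases "K = {}") (auto intro!: closedin_Int closedin_INT)
  qed
  have "\<Union> (range A) = S"
  proof (intro equalityI subsetI)
    fix x assume x: "x \<in> S"
    obtain B where B: "\<And>f. f \<in> K \<Longrightarrow> norm (f x) \<le> B"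
      using pointwise[OF x] by blast
    obtain n :: nat where "B \<le> real n"
      using real_arch_simple by blast
    then show "x \<in> \<Union> (range A)"
      using B x by (force simp: A_def intro: order_trans)
  qed (auto simp: A_def)
  moreover have "top_of_set S interior_of S = S"
    using interior_of_topspace[of "top_of_set S"] by simp
  moreover have "S \<noteq> {}"
    using subspace_0[OF S(2)] by blast
  ultimately have "top_of_set S interior_of \<Union> (range A) \<noteq> {}"
    by simp
  moreover have "completely_metrizable_space (top_of_set S)"
    using S(1) by (intro completely_metrizable_space_closedin completely_metrizable_space_euclidean) simp
  \<comment> \<open>By completeness, countably many relatively closed sets with empty interior
    cannot have a union with nonempty interior.\<close>
  ultimately obtain n where "top_of_set S interior_of A n \<noteq> {}"
    using Baire_category_alt[of "top_of_set S" "range A"] closed by auto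
  then obtain x0 V where V: "openin (top_of_set S) V" "x0 \<in> V" "V \<subseteq> A n"
    unfolding interior_of_def by blast
  then obtain r where r: "r > 0" "\<And>y. y \<in> S \<Longrightarrow> dist y x0 < r \<Longrightarrow> y \<in> A n"
    unfolding openin_euclidean_subtopology_iff by blast
  have x0: "x0 \<in> A n" "x0 \<in> S"
    using V by (auto simp: A_def)
  have "norm (f x) \<le> 4 * real n / r * norm x" if f: "f \<in> K" and x: "x \<in> S" for f x
  proof (cases "x = 0")
    case True
    then show ?thesis
      using scale[OF f subspace_0[OF S(2)], of 0] by simp
  next
    case False
    \<comment> \<open>Scaling \<open>x\<close> to half the radius keeps
      \<open>x0 + t *\<^sub>R x\<close> inside the ball. Then \<open>f (t *\<^sub>R x)\<close> is a
      difference of two values of norm at most \<open>n\<close>, and dividing \<open>2 * n\<close>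
      by \<open>t\<close> yields the constant \<open>4 * n / r\<close>.\<close>
    define t where "t = r / (2 * norm x)"
    have t: "t > 0"
      using False r(1) by (simp add: t_def)
    have tx: "t *\<^sub>R x \<in> S"
      by (rule subspace_scale[OF S(2) x])
    have "x0 + t *\<^sub>R x \<in> A n"
      using r(1) False by (intro r(2) subspace_add[OF S(2)] x0 tx) (simp add: dist_norm t_def)
    then have "norm (f x0 + t *\<^sub>R f x) \<le> real n" "norm (f x0) \<le> real n"
      using f x0 by (auto simp: A_def add[OF f x0(2) tx] scale[OF f x])
    then have "norm (t *\<^sub>R f x) \<le> 2 * real n"
      using norm_triangle_ineq4[of "f x0 + t *\<^sub>R f x" "f x0"] by simp
    then have "t * norm (f x) \<le> 2 * real n"
      using t by simp
    then show ?thesis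
      using False r(1) by (simp add: t_def field_simps)
  qed
  then show ?thesis by blast
qed


subsection \<open>Comparison with the norm topology\<close>

text \<open>These two properties are what makes the balls of \<open>p\<close> open in the norm
  topology of \<open>BH\<close>.\<close>

definition bounded_seminorm :: "(('a::complex_hilbert \<Rightarrow>\<^sub>L 'a) \<Rightarrow> real) \<Rightarrow> bool" where
  "bounded_seminorm p \<longleftrightarrow>
     (\<forall>a\<in>BH. \<forall>b\<in>BH. p (a + b) \<le> p a + p b) \<and> (\<exists>C. \<forall>a\<in>BH. p a \<le> C * norm a)"

lemma bounded_seminormI:
  assumes "\<And>a b. a \<in> BH \<Longrightarrow> b \<in> BH \<Longrightarrow> p (a + b) \<le> p a + p b"
    and "\<And>a. a \<in> BH \<Longrightarrow> p a \<le> C * norm a"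
  shows "bounded_seminorm p"
  using assms by (auto simp: bounded_seminorm_def)

lemmas BH_diff = subspace_diff[OF subspace_BH]

lemma openin_seminorm_topology_imp_norm_open:
  assumes P: "\<And>p. p \<in> P \<Longrightarrow> bounded_seminorm p" and U: "openin (seminorm_topology P) U"
  shows "openin (top_of_set BH) U"
proof -
  have "openin (top_of_set BH) {b \<in> BH. p (b - a) < r}" if p: "p \<in> P" and a: "a \<in> BH" for p a r
    unfolding openin_euclidean_subtopology_iff
  proof (intro conjI ballI)
    fix b assume "b \<in> {b \<in> BH. p (b - a) < r}"
    then have b: "b \<in> BH" "p (b - a) < r" by auto
    have sub: "\<And>x y. x \<in> BH \<Longrightarrow> y \<in> BH \<Longrightarrow> p (x + y) \<le> p x + p y"
      using P[OF p] by (simp add: bounded_seminorm_def)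
    obtain C where C: "\<And>x. x \<in> BH \<Longrightarrow> p x \<le> C * norm x"
      using P[OF p] by (auto simp: bounded_seminorm_def)
    \<comment> \<open>The radius is the remaining slack divided by a constant that is at least
      \<open>C\<close> and positive whatever the sign of \<open>C\<close>.\<close>
    define s where "s = (r - p (b - a)) / (\<bar>C\<bar> + 1)"
    have "c \<in> {b \<in> BH. p (b - a) < r}" if c: "c \<in> BH" "dist c b < s" for c
    proof -
      have "p (c - a) = p ((c - b) + (b - a))"
        by simp
      also have "\<dots> \<le> p (c - b) + p (b - a)"
        by (intro sub BH_diff a b(1) c(1))
      also have "p (c - b) \<le> C * norm (c - b)"
        by (rule C[OF BH_diff[OF c(1) b(1)]])
      also have "\<dots> \<le> (\<bar>C\<bar> + 1) * norm (c - b)"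
        by (intro mult_right_mono) auto
      also have "\<dots> < r - p (b - a)"
        using c(2) by (simp add: s_def dist_norm pos_less_divide_eq mult.commute)
      finally show ?thesis
        using c by simp
    qed
    moreover have "s > 0"
      using b(2) by (simp add: s_def)
    ultimately show "\<exists>s>0. \<forall>c\<in>BH. dist c b < s \<longrightarrow> c \<in> {b \<in> BH. p (b - a) < r}"
      by blast
  qed auto
  then have open_basis: "openin (top_of_set BH) V"
    if "V \<in> {{b \<in> BH. p (b - a) < r} | p a r. p \<in> P \<and> a \<in> BH \<and> r > 0}" for V
    using that by auto
  show ?thesis
    by (rule generate_topology_on_coarsest[OF istopology_openin open_basis])
      (use U in \<open>simp_all add: seminorm_topology_def openin_topology_generated_by_iff\<close>)
qed

text \<open>The carrier of a generated topology is only the union of its generators, so one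
  generator containing \<open>0\<close> must be exhibited.\<close>

lemma zero_in_topspace_seminorm_topology:
  assumes "P \<noteq> {}"
  shows "0 \<in> topspace (seminorm_topology P)"
proof -
  obtain p where "p \<in> P"
    using assms by blast
  \<comment> \<open>Here \<open>p\<close> is an arbitrary function and \<open>p 0\<close> may be
    nonzero, hence a radius exceeding \<open>p 0\<close>.\<close>
  then have "{b \<in> BH. p (b - 0) < \<bar>p 0\<bar> + 1} \<in> {{b \<in> BH. p (b - a) < r} | p a r. p \<in> P \<and> a \<in> BH \<and> r > 0}"
    using subspace_0[OF subspace_BH]
    by (intro CollectI exI[of _ p] exI[of _ 0] exI[of _ "\<bar>p 0\<bar> + 1"]) auto
  moreover have "0 \<in> {b \<in> BH. p (b - 0) < \<bar>p 0\<bar> + 1}"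
    using subspace_0[OF subspace_BH] by auto
  ultimately show ?thesis
    unfolding seminorm_topology_def topology_generated_by_topspace by (rule UnionI)
qed

text \<open>\<open>closure_of\<close> ignores points outside the carrier, so membership of
  \<open>0\<close> is recorded along with the comparison of open sets.\<close>

definition coarser_than_norm :: "('a::complex_hilbert \<Rightarrow>\<^sub>L 'a) topology \<Rightarrow> bool" where
  "coarser_than_norm T \<longleftrightarrow> 0 \<in> topspace T \<and> (\<forall>U. openin T U \<longrightarrow> openin (top_of_set BH) U)"

lemma coarser_seminorm_topology:
  assumes "P \<noteq> {}" and "\<And>p. p \<in> P \<Longrightarrow> bounded_seminorm p"
  shows "coarser_than_norm (seminorm_topology P)"
  using assms zero_in_topspace_seminorm_topology openin_seminorm_topology_imp_norm_open
  unfolding coarser_than_norm_def by blast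

section \<open>The individual topologies\<close>

lemma coarser_operator_norm: "coarser_than_norm operator_norm_topology"
  using subspace_0[OF subspace_BH] by (simp add: coarser_than_norm_def operator_norm_topology_def)

lemma coarser_strong_operator: "coarser_than_norm (subtopology strong_operator_topology BH)"
proof -
  have "open V" if "openin strong_operator_topology V" for V :: "('a \<Rightarrow>\<^sub>L 'a) set"
    using openin_continuous_map_preimage[OF strong_operator_topology_weaker_than_euclidean that] by simp
  then show ?thesis
    using subspace_0[OF subspace_BH]
    by (auto simp: coarser_than_norm_def openin_subtopology openin_open strong_operator_topology_topspace Int_commute)
qed

lemma coarser_weak_operator: "coarser_than_norm weak_operator_topology"
  unfolding weak_operator_topology_def
proof (rule coarser_seminorm_topology)
  fix p :: "('a \<Rightarrow>\<^sub>L 'a) \<Rightarrow> real"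
  assume "p \<in> {\<lambda>a. cmod (cinner (blinfun_apply a x) y) | x y. True}"
  then obtain x y where p: "p = (\<lambda>a. cmod (cinner (blinfun_apply a x) y))" by blast
  have "cmod (cinner (blinfun_apply a x) y) \<le> (norm x * norm y) * norm a" for a
    using cmod_cinner_blinfun_le[of a x y] by (simp add: mult_ac)
  then show "bounded_seminorm p"
    unfolding p by (rule bounded_seminormI[rotated]) (simp add: blinfun.add_left cinner_add_left norm_triangle_ineq)
qed auto

lemma coarser_weak_banach: "coarser_than_norm weak_banach_topology"
  unfolding weak_banach_topology_def weak_topology_def
proof (rule coarser_seminorm_topology)
  have "(\<lambda>a\<in>BH. 0) \<in> norm_dual"
    by (auto simp: norm_dual_def BH_add scaleC_op_in_BH intro!: exI[of _ 0])
  then show "{\<lambda>a. cmod (f a) | f. f \<in> norm_dual} \<noteq> {}"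
    by blast
next
  fix p :: "('a \<Rightarrow>\<^sub>L 'a) \<Rightarrow> real"
  assume "p \<in> {\<lambda>a. cmod (f a) | f. f \<in> norm_dual}"
  then show "bounded_seminorm p"
    by (auto simp: bounded_seminorm_def norm_dual_def norm_triangle_ineq)
qed

text \<open>Cauchy-Schwarz and the square summability of \<open>x\<close> and \<open>y\<close>
  dominate the defining series by \<open>norm a\<close> times a convergent series. Absolute
  convergence justifies termwise linearity, and the sum of the dominating series is the
  bound.\<close>

lemma
  assumes "f \<in> predual"
  shows predual_add: "\<And>a b. a \<in> BH \<Longrightarrow> b \<in> BH \<Longrightarrow> f (a + b) = f a + f b"
    and predual_scaleR: "\<And>a r. a \<in> BH \<Longrightarrow> f (r *\<^sub>R a) = r *\<^sub>R f a"
    and predual_bounded: "\<exists>C. \<forall>a\<in>BH. cmod (f a) \<le> C * norm a"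
proof -
  obtain x y :: "nat \<Rightarrow> 'a" where f: "f = (\<lambda>a\<in>BH. \<Sum>n. cinner (blinfun_apply a (x n)) (y n))"
    and xy: "square_summable x" "square_summable y"
    using assms by (auto simp: predual_def)
  have sum: "summable (\<lambda>n. norm (x n) * norm (y n))"
  proof (rule summable_comparison_test')
    show "summable (\<lambda>n. (norm (x n))\<^sup>2 + (norm (y n))\<^sup>2)"
      using xy by (intro summable_add) (simp_all add: square_summable_def)
    show "norm (norm (x n) * norm (y n)) \<le> (norm (x n))\<^sup>2 + (norm (y n))\<^sup>2" for n
      using sum_squares_bound[of "norm (x n)" "norm (y n)"] mult_nonneg_nonneg[of "norm (x n)" "norm (y n)"]
      by (simp add: abs_mult del: mult_nonneg_nonneg)
  qed
  have le: "cmod (cinner (blinfun_apply a (x n)) (y n)) \<le> norm a * (norm (x n) * norm (y n))" for a n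
    using cmod_cinner_blinfun_le[of a "x n" "y n"] by (simp add: mult.assoc)
  have abs: "summable (\<lambda>n. cmod (cinner (blinfun_apply a (x n)) (y n)))" for a
    by (rule summable_comparison_test'[OF summable_mult[OF sum, of "norm a"]]) (simp add: le)
  then have summable: "summable (\<lambda>n. cinner (blinfun_apply a (x n)) (y n))" for a
    by (rule summable_norm_cancel)
  show "f (a + b) = f a + f b" if "a \<in> BH" "b \<in> BH" for a b
    using that by (simp add: f BH_add blinfun.add_left cinner_add_left suminf_add summable)
  show "f (r *\<^sub>R a) = r *\<^sub>R f a" if "a \<in> BH" for a r
    using that summable[of a]
    by (simp add: f subspace_scale[OF subspace_BH] blinfun.scaleR_left suminf_scaleR_right
        linear_scale[OF bounded_linear.linear[OF bounded_linear_cinner_left]])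
  have "cmod (f a) \<le> (\<Sum>n. norm (x n) * norm (y n)) * norm a" if "a \<in> BH" for a
  proof -
    have "cmod (f a) \<le> (\<Sum>n. cmod (cinner (blinfun_apply a (x n)) (y n)))"
      using that summable_norm[OF abs] by (simp add: f)
    also have "\<dots> \<le> (\<Sum>n. norm a * (norm (x n) * norm (y n)))"
      by (intro suminf_le le abs summable_mult sum)
    finally show ?thesis
      by (simp add: suminf_mult[OF sum] mult.commute)
  qed
  then show "\<exists>C. \<forall>a\<in>BH. cmod (f a) \<le> C * norm a" by blast
qed

lemma zero_in_predual: "(\<lambda>a\<in>BH. 0) \<in> predual"
  unfolding predual_def
  by (rule CollectI, rule exI[of _ "\<lambda>_. 0"], rule exI[of _ "\<lambda>_. 0"])
    (simp add: square_summable_def cinner_zero_left)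

lemma coarser_ultraweak: "coarser_than_norm ultraweak_topology"
  unfolding ultraweak_topology_def weak_topology_def
proof (rule coarser_seminorm_topology)
  show "{\<lambda>a. cmod (f a) | f. f \<in> predual} \<noteq> {}"
    using zero_in_predual by blast
next
  fix p :: "('a \<Rightarrow>\<^sub>L 'a) \<Rightarrow> real"
  assume "p \<in> {\<lambda>a. cmod (f a) | f. f \<in> predual}"
  then show "bounded_seminorm p"
    using predual_bounded by (auto simp: bounded_seminorm_def predual_add norm_triangle_ineq)
qed

section \<open>Compact sets of normal functionals and the Arens--Mackey topology\<close>

lemma closed_BH: "closed (BH :: ('a::complex_hilbert \<Rightarrow>\<^sub>L 'a) set)"
proof -
  have "closed {a :: 'a \<Rightarrow>\<^sub>L 'a. blinfun_apply a (c *\<^sub>C x) = c *\<^sub>C blinfun_apply a x}" for c x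
    by (intro closed_Collect_eq continuous_intros bounded_linear.continuous_on[OF bounded_linear_scaleC])
  then show ?thesis
    unfolding BH_def by (intro closed_Collect_all)
qed

lemma pointwise_compact_uniformly_bounded:
  fixes K :: "(('a::complex_hilbert \<Rightarrow>\<^sub>L 'a) \<Rightarrow> complex) set"
  assumes "compactin (pointwise_topology predual) K"
  shows "\<exists>C. \<forall>f\<in>K. \<forall>a\<in>BH. cmod (f a) \<le> C * norm a"
proof (rule uniform_boundedness[OF closed_BH subspace_BH])
  have K: "K \<subseteq> predual" "compactin (product_topology (\<lambda>_. euclidean) BH) K"
    using assms by (auto simp: pointwise_topology_def compactin_subtopology)
  fix f assume "f \<in> K"
  then have f: "f \<in> predual" using K by blast
  show "f (a + b) = f a + f b" if "a \<in> BH" "b \<in> BH" for a b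
    using predual_add[OF f that] .
  show "f (r *\<^sub>R a) = r *\<^sub>R f a" if "a \<in> BH" for a r
    using predual_scaleR[OF f that] .
  obtain C where C: "\<And>a. a \<in> BH \<Longrightarrow> cmod (f a) \<le> C * norm a"
    using predual_bounded[OF f] by blast
  \<comment> \<open>Linearity and the norm bound make \<open>f\<close> Lipschitz; the absolute value
    of \<open>C\<close> supplies a nonnegative constant.\<close>
  show "continuous_on BH f"
  proof (rule continuous_on_subset[OF lipschitz_on_continuous_on[of "\<bar>C\<bar>"] order_refl], rule lipschitz_onI)
    fix a b :: "'a \<Rightarrow>\<^sub>L 'a" assume ab: "a \<in> BH" "b \<in> BH"
    have "f a = f (a - b) + f b"
      using predual_add[OF f BH_diff[OF ab] ab(2)] by simp
    then have "dist (f a) (f b) \<le> C * norm (a - b)"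
      using C[OF BH_diff[OF ab]] by (simp add: dist_norm)
    also have "\<dots> \<le> \<bar>C\<bar> * dist a b"
      unfolding dist_norm by (intro mult_right_mono) auto
    finally show "dist (f a) (f b) \<le> \<bar>C\<bar> * dist a b" .
  qed simp
next
  fix a :: "'a \<Rightarrow>\<^sub>L 'a" assume "a \<in> BH"
  then have "continuous_map (product_topology (\<lambda>_. euclidean) BH) euclidean (\<lambda>f :: _ \<Rightarrow> complex. f a)"
    by (rule continuous_map_product_projection)
  \<comment> \<open>Evaluation at \<open>a\<close> is a coordinate projection, so compactness of
    \<open>K\<close> yields the pointwise bounds.\<close>
  then have "compact ((\<lambda>f. f a) ` K)"
    using assms image_compactin by (fastforce simp: pointwise_topology_def compactin_subtopology)
  then have "bounded ((\<lambda>f. f a) ` K)"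
    by (rule compact_imp_bounded)
  then show "\<exists>B. \<forall>f\<in>K. cmod (f a) \<le> B"
    by (auto simp: bounded_iff)
qed

lemma coarser_arens_mackey: "coarser_than_norm arens_mackey_topology"
  unfolding arens_mackey_topology_def mackey_topology_def
proof (rule coarser_seminorm_topology)
  have "absolutely_convex {\<lambda>a\<in>BH. 0}"
    by (auto simp: absolutely_convex_def fun_eq_iff)
  moreover have "compactin (pointwise_topology predual) {\<lambda>a\<in>BH. 0}"
    using zero_in_predual by (simp add: pointwise_topology_def)
  ultimately show "{\<lambda>a. SUP f\<in>K. cmod (f a) | K. K \<noteq> {} \<and> absolutely_convex K \<and>
      compactin (pointwise_topology predual) K} \<noteq> {}"
    by blast
next
  fix p :: "('a \<Rightarrow>\<^sub>L 'a) \<Rightarrow> real"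
  assume "p \<in> {\<lambda>a. SUP f\<in>K. cmod (f a) | K. K \<noteq> {} \<and> absolutely_convex K \<and>
      compactin (pointwise_topology predual) K}"
  then obtain K where p: "p = (\<lambda>a. SUP f\<in>K. cmod (f a))" and K: "K \<noteq> {}"
    "compactin (pointwise_topology predual) K"
    by blast
  have sub: "K \<subseteq> predual"
    using K(2) by (auto simp: pointwise_topology_def compactin_subtopology)
  obtain C where C: "\<And>f a. f \<in> K \<Longrightarrow> a \<in> BH \<Longrightarrow> cmod (f a) \<le> C * norm a"
    using pointwise_compact_uniformly_bounded[OF K(2)] by blast
  \<comment> \<open>The uniform bound \<open>C\<close> is what makes this real supremum an actual
    upper bound.\<close>
  have le: "cmod (f a) \<le> p a" if "f \<in> K" "a \<in> BH" for f a
    unfolding p using that C by (intro cSUP_upper bdd_aboveI2) auto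
  show "bounded_seminorm p"
  proof (rule bounded_seminormI)
    fix a b :: "'a \<Rightarrow>\<^sub>L 'a" assume ab: "a \<in> BH" "b \<in> BH"
    have "cmod (f (a + b)) \<le> p a + p b" if "f \<in> K" for f
    proof -
      have "f (a + b) = f a + f b"
        using that sub ab predual_add by blast
      then show ?thesis
        using norm_triangle_ineq[of "f a" "f b"] le[OF that ab(1)] le[OF that ab(2)] by simp
    qed
    then show "p (a + b) \<le> p a + p b"
      unfolding p[THEN fun_cong, of "a + b"] using K(1) by (intro cSUP_least)
  next
    show "p a \<le> C * norm a" if "a \<in> BH" for a
      unfolding p using K(1) C that by (intro cSUP_least)
  qed
qed

text \<open>Minkowski's inequality for partial sums, followed by passage to the limit; the bound on
  partial sums also gives the summability of the squares of \<open>w\<close>.\<close>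

lemma sqrt_suminf_triangle:
  fixes u v w :: "nat \<Rightarrow> real"
  assumes sum: "summable (\<lambda>n. (u n)\<^sup>2)" "summable (\<lambda>n. (v n)\<^sup>2)"
    and w: "\<And>n. 0 \<le> w n" "\<And>n. w n \<le> u n + v n"
  shows "sqrt (\<Sum>n. (w n)\<^sup>2) \<le> sqrt (\<Sum>n. (u n)\<^sup>2) + sqrt (\<Sum>n. (v n)\<^sup>2)"
proof -
  define s where "s = sqrt (\<Sum>n. (u n)\<^sup>2) + sqrt (\<Sum>n. (v n)\<^sup>2)"
  have "0 \<le> s"
    using sum by (simp add: s_def suminf_nonneg)
  have partial: "(\<Sum>n<N. (w n)\<^sup>2) \<le> s\<^sup>2" for N
  proof -
    have "L2_set w {..<N} \<le> L2_set (\<lambda>n. u n + v n) {..<N}"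
      using w by (intro L2_set_mono)
    also have "\<dots> \<le> L2_set u {..<N} + L2_set v {..<N}"
      by (rule L2_set_triangle_ineq)
    also have "\<dots> \<le> s"
      unfolding s_def L2_set_def using sum
      by (intro add_mono real_sqrt_le_mono sum_le_suminf) auto
    finally show ?thesis
      unfolding L2_set_def by (rule sqrt_le_D)
  qed
  have "(\<Sum>n. (w n)\<^sup>2) \<le> s\<^sup>2"
    by (rule suminf_le_const[OF summableI_nonneg_bounded[OF _ partial] partial]) simp
  then show ?thesis
    unfolding s_def[symmetric] using \<open>0 \<le> s\<close> by (simp add: real_le_lsqrt)
qed

text \<open>\<open>F\<close> stands for application of the operator or of its adjoint, so this
  serves both the ultrastrong and the ultrastrong* topology.\<close>

lemma bounded_seminorm_square_sum:
  fixes F :: "('a::complex_hilbert \<Rightarrow>\<^sub>L 'a) \<Rightarrow> 'a \<Rightarrow> 'a"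
  assumes x: "square_summable x"
    and add: "\<And>a b v. a \<in> BH \<Longrightarrow> b \<in> BH \<Longrightarrow> F (a + b) v = F a v + F b v"
    and bound: "\<And>a v. a \<in> BH \<Longrightarrow> norm (F a v) \<le> norm a * norm v"
  shows "bounded_seminorm (\<lambda>a. sqrt (\<Sum>n. (norm (F a (x n)))\<^sup>2))"
proof -
  have le: "(norm (F a (x n)))\<^sup>2 \<le> (norm a)\<^sup>2 * (norm (x n))\<^sup>2" if "a \<in> BH" for a n
    using power_mono[OF bound[OF that]] by (simp add: power_mult_distrib)
  have sum_x: "summable (\<lambda>n. (norm (x n))\<^sup>2)"
    using x by (simp add: square_summable_def)
  have sum: "summable (\<lambda>n. (norm (F a (x n)))\<^sup>2)" if "a \<in> BH" for a
    by (rule summable_comparison_test'[OF summable_mult[OF sum_x, of "(norm a)\<^sup>2"]]) (simp add: le that)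
  show ?thesis
  proof (rule bounded_seminormI)
    fix a b :: "'a \<Rightarrow>\<^sub>L 'a" assume "a \<in> BH" "b \<in> BH"
    then show "sqrt (\<Sum>n. (norm (F (a + b) (x n)))\<^sup>2)
        \<le> sqrt (\<Sum>n. (norm (F a (x n)))\<^sup>2) + sqrt (\<Sum>n. (norm (F b (x n)))\<^sup>2)"
      by (intro sqrt_suminf_triangle sum) (simp_all add: add norm_triangle_ineq)
  next
    fix a :: "'a \<Rightarrow>\<^sub>L 'a" assume a: "a \<in> BH"
    have "(\<Sum>n. (norm (F a (x n)))\<^sup>2) \<le> (\<Sum>n. (norm a)\<^sup>2 * (norm (x n))\<^sup>2)"
      by (intro suminf_le le a sum summable_mult sum_x)
    also have "\<dots> = (norm a)\<^sup>2 * (\<Sum>n. (norm (x n))\<^sup>2)"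
      by (rule suminf_mult[OF sum_x])
    finally have "sqrt (\<Sum>n. (norm (F a (x n)))\<^sup>2) \<le> sqrt ((norm a)\<^sup>2 * (\<Sum>n. (norm (x n))\<^sup>2))"
      by (rule real_sqrt_le_mono)
    then show "sqrt (\<Sum>n. (norm (F a (x n)))\<^sup>2) \<le> sqrt (\<Sum>n. (norm (x n))\<^sup>2) * norm a"
      by (simp add: real_sqrt_mult mult.commute)
  qed
qed

lemma square_summable_zero: "square_summable (\<lambda>_. 0)"
  by (simp add: square_summable_def)

lemma bounded_seminorm_apply: "bounded_seminorm (\<lambda>a. norm (blinfun_apply a x))"
  by (rule bounded_seminormI[where C = "norm x"])
    (simp_all add: blinfun.add_left norm_triangle_ineq norm_blinfun mult.commute[of "norm x"])

lemma coarser_ultrastrong: "coarser_than_norm ultrastrong_topology"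
  unfolding ultrastrong_topology_def
  using square_summable_zero
  by (intro coarser_seminorm_topology)
    (auto intro!: bounded_seminorm_square_sum simp: blinfun.add_left norm_blinfun)

section \<open>Topologies involving adjoints, and \<open>0\<close> as a closure point\<close>

context orthonormal_basis
begin

lemma coarser_strong_star: "coarser_than_norm (strong_star_operator_topology :: ('a \<Rightarrow>\<^sub>L 'a) topology)"
proof -
  have "bounded_seminorm (\<lambda>a :: 'a \<Rightarrow>\<^sub>L 'a. norm (blinfun_apply (adjoint_op a) x))" for x
    by (rule bounded_seminormI[where C = "norm x"])
      (simp_all add: adjoint_op_add norm_triangle_ineq norm_adjoint_op_apply_le mult.commute[of "norm x"])
  then show ?thesis
    unfolding strong_star_operator_topology_def
    by (intro coarser_seminorm_topology) (auto simp: bounded_seminorm_apply)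
qed

lemma coarser_ultrastrong_star: "coarser_than_norm (ultrastrong_star_topology :: ('a \<Rightarrow>\<^sub>L 'a) topology)"
  unfolding ultrastrong_star_topology_def
  using square_summable_zero
  by (intro coarser_seminorm_topology)
    (auto intro!: bounded_seminorm_square_sum
      simp: blinfun.add_left norm_blinfun adjoint_op_add norm_adjoint_op_apply_le)

lemma zero_in_closure_of_perm_ops:
  assumes T: "coarser_than_norm T"
  shows "0 \<in> T closure_of (convex hull (perm_op e ` {\<rho>. bij \<rho>}))"
  unfolding in_closure_of
proof (intro conjI allI impI)
  show "0 \<in> topspace T"
    using T by (simp add: coarser_than_norm_def)
  fix U assume "0 \<in> U \<and> openin T U"
  then have "0 \<in> U" "openin (top_of_set BH) U"
    using T by (auto simp: coarser_than_norm_def)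
  then obtain r where "r > 0" "\<And>b. b \<in> BH \<Longrightarrow> dist b 0 < r \<Longrightarrow> b \<in> U"
    unfolding openin_euclidean_subtopology_iff by blast
  then show "\<exists>b. b \<in> convex hull (perm_op e ` {\<rho>. bij \<rho>}) \<and> b \<in> U"
    using zero_limit_of_perm_ops[of r] by auto
qed

end

section \<open>Separating \<open>0\<close> from the doubly stochastic operators\<close>

lemma zero_notin_DS: "0 \<notin> DS e"
proof
  assume "0 \<in> DS e"
  then have "(\<lambda>k::nat. 0::complex) sums 1"
    by (simp add: DS_def mat_entry_def cinner_zero_left)
  then show False
    using sums_unique2[OF sums_zero] by force
qed

theorem corollary2p15:
  fixes e :: "nat \<Rightarrow> 'a::complex_hilbert"
    and T :: "('a \<Rightarrow>\<^sub>L 'a) topology"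
  assumes "is_orthonormal_basis e"
    and "T \<in> {weak_operator_topology, ultraweak_topology,
      subtopology strong_operator_topology BH, strong_star_operator_topology,
      ultrastrong_topology, ultrastrong_star_topology,
      arens_mackey_topology, weak_banach_topology, operator_norm_topology}"
  shows "T closure_of (convex hull (perm_op e ` {\<rho>. bij \<rho>})) \<noteq> DS e"
proof -
  interpret orthonormal_basis e
    by unfold_locales (rule assms(1))
  have "coarser_than_norm T"
    using assms(2) coarser_weak_operator coarser_ultraweak coarser_strong_operator coarser_strong_star
      coarser_ultrastrong coarser_ultrastrong_star coarser_arens_mackey coarser_weak_banach
      coarser_operator_norm by blast
  then show ?thesis
    using zero_in_closure_of_perm_ops zero_notin_DS by blast
qed

end
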